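(* Let $\alpha\ge0$ and $\beta\ge0$ be real numbers. The double inequality $$\sqrt{2\pi}\,x^{x-1/2}\exp\left[\frac{\psi'(x+\beta)}{12}-x\right]<\Gamma(x)<\sqrt{2\pi}\,x^{x-1/2}\exp\left[\frac{\psi'(x+\alpha)}{12}-x\right]$$ is valid for all $x>0$ if and only if $\alpha=0$ and $\beta\ge\frac12$.
   Context: $\Gamma(x)=\int_0^\infty t^{x-1}e^{-t}\,dt$ for $x>0$ is the gamma function, $\psi(x)=\Gamma'(x)/\Gamma(x)$ is the di-gamma function, and $\psi'$ is its derivative (the tri-gamma function). *)

theory Defs
  imports "HOL-Analysis.Analysis"
begin

text \<open>
  \<open>Gamma\<close> and \<open>Digamma\<close> are introduced in the library by limits. On the positive reals they are
  Euler's integral (library fact \<open>Gamma_integral_real\<close>) and the logarithmic derivative of \<open>Gamma\<close> (lemma below).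
\<close>

lemma Digamma_eq_deriv_Gamma_over_Gamma:
  fixes x :: real
  assumes "x > 0"
  shows "Digamma x = deriv Gamma x / Gamma x"
proof -
  have nz: "x \<notin> \<int>\<^sub>\<le>\<^sub>0"
    using assms by (auto elim!: nonpos_Ints_cases)
  have "deriv Gamma x = Gamma x * Digamma x"
    by (rule DERIV_imp_deriv, rule has_field_derivative_Gamma[OF nz])
  moreover have "Gamma x \<noteq> 0"
    using Gamma_real_pos[OF assms] by simp
  ultimately show ?thesis by simp
qed

end

theory Submission
  imports Defs "HOL-Real_Asymp.Real_Asymp"
begin

text \<open>
  Let \<open>binet x\<close> be the remainder in Stirling's formula, so that the double inequality reads
  \<open>\<psi>'(x + \<beta>) / 12 < binet x < \<psi>'(x + \<alpha>) / 12\<close>. Both \<open>binet\<close> and \<open>\<psi>'\<close> vanish at infinity, so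
  it suffices to compare their differences under \<open>x \<mapsto> x + 1\<close>: for \<open>\<psi>'\<close> the difference is \<open>1 / x\<^sup>2\<close>,
  for \<open>binet\<close> it is \<open>(x + 1/2) ln (1 + 1/x) - 1\<close>, which lies between \<open>1 / (12 (x + 1/2)\<^sup>2)\<close> and
  \<open>1 / (12 x (x + 1))\<close>. For \<open>\<beta> < 1/2\<close> and large \<open>x\<close> we have \<open>(x + \<beta>)\<^sup>2 < x (x + 1)\<close>, so the same
  comparison reverses the lower bound. For \<open>\<alpha> > 0\<close> the upper bound fails near \<open>0\<close>, where \<open>binet\<close>
  is unbounded and \<open>\<psi>'(x + \<alpha>)\<close> is not.
\<close>

section \<open>Binet's function and bounds for its unit differences\<close>

definition binet :: "real \<Rightarrow> real" where
  "binet x = ln_Gamma x - ((x - 1/2) * ln x - x + ln (2 * pi) / 2)"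

lemma ln_Gamma_real_plus1:
  fixes x :: real
  assumes "x > 0"
  shows "ln_Gamma (x + 1) = ln x + ln_Gamma x"
proof -
  have "x \<notin> \<int>\<^sub>\<le>\<^sub>0" using assms by (auto elim!: nonpos_Ints_cases)
  then show ?thesis
    using assms Gamma_real_pos[of x] by (simp add: ln_Gamma_real_pos Gamma_plus1 ln_mult_pos)
qed

lemma Gamma_conv_binet:
  fixes x :: real
  assumes "x > 0"
  shows "Gamma x = sqrt (2 * pi) * x powr (x - 1/2) * exp (binet x - x)"
proof -
  have "sqrt (2 * pi) = exp (ln (2 * pi) / 2)"
    by (simp flip: ln_sqrt)
  then have "sqrt (2 * pi) * x powr (x - 1/2) * exp (binet x - x) = exp (ln_Gamma x)"
    using assms by (simp add: binet_def powr_def flip: exp_add)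
  then show ?thesis
    using assms by (simp add: Gamma_real_pos_exp)
qed

lemma binet_diff:
  assumes "x > 0"
  shows "binet x - binet (x + 1) = (x + 1/2) * ln (1 + 1/x) - 1"
proof -
  have "1 + 1/x = (x + 1) / x" using assms by (simp add: field_simps)
  then have ln_eq: "ln (1 + 1/x) = ln (x + 1) - ln x" using assms by (simp add: ln_divide_pos)
  show ?thesis
    unfolding binet_def ln_eq ln_Gamma_real_plus1[OF assms] by (simp add: algebra_simps)
qed

lemma binet_diff_bounds:
  assumes "x > 0"
  shows "1 / (12 * (x + 1/2)^2) < binet x - binet (x + 1)"
    and "binet x - binet (x + 1) \<le> 1 / (12 * x * (x + 1))"
proof -
  \<comment> \<open>\<open>ln (1 + 1/x) = 2 artanh u\<close>, expanded in powers of \<open>u\<close>\<close>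
  define u where "u = 1 / (2 * x + 1)"
  have u: "0 < u" "u < 1" using assms by (simp_all add: u_def)
  have x: "x + 1/2 = 1 / (2 * u)" using assms by (simp add: u_def field_simps)
  have y: "(1 + 1/x - 1) / (1 + 1/x + 1) = u"
    using assms by (simp add: u_def field_simps)
  have gt1: "1 + 1/x > 1" using assms by simp
  \<comment> \<open>The cubic term alone yields \<open>1 / (12 * (x + 1/2)^2)\<close>; the positive
    fifth-power term makes the bound strict.\<close>
  have "2 * u + 2 * u^3 / 3 + 2 * u^5 / 5 \<le> ln (1 + 1/x)"
    using ln_approx_bounds[OF gt1, of 3] unfolding y
    by (simp add: eval_nat_numeral)
  moreover have "2 * u^5 / 5 > 0" using u by simp
  ultimately have "(x + 1/2) * (2 * u + 2 * u^3 / 3) < (x + 1/2) * ln (1 + 1/x)"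
    using assms by (intro mult_strict_left_mono) linarith+
  also have "(x + 1/2) * (2 * u + 2 * u^3 / 3) = 1 + u^2 / 3"
    unfolding x using u by (simp add: field_simps power2_eq_square power3_eq_cube)
  also have "u^2 / 3 = 1 / (12 * (x + 1/2)^2)"
    unfolding x using u by (simp add: field_simps power2_eq_square)
  finally show "1 / (12 * (x + 1/2)^2) < binet x - binet (x + 1)"
    using assms by (simp add: binet_diff)
  \<comment> \<open>One term is kept; the tail is dominated by a geometric series of ratio
    \<open>u^2\<close> with all coefficients replaced by \<open>1/3\<close>.\<close>
  have "ln (1 + 1/x) \<le> 2 * u + 2 * (u^3 / (1 - u^2) / 3)"
    using ln_approx_bounds[OF gt1, of 1] unfolding y
    by (simp add: eval_nat_numeral)
  then have "(x + 1/2) * ln (1 + 1/x) \<le> (x + 1/2) * (2 * u + 2 * (u^3 / (1 - u^2) / 3))"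
    using assms by (intro mult_left_mono) auto
  also have "\<dots> = 1 + u^2 / (1 - u^2) / 3"
    unfolding x using u by (simp add: field_simps power2_eq_square power3_eq_cube)
  also have "u^2 / (1 - u^2) = 1 / (4 * x * (x + 1))"
  proof -
    have "4 * x * (x + 1) * u^2 = ((2 * x + 1) * u)^2 - u^2"
      by (simp add: power2_eq_square algebra_simps)
    moreover have "(2 * x + 1) * u = 1" using assms by (simp add: u_def)
    ultimately have "1 - u^2 = 4 * x * (x + 1) * u^2" by simp
    then show ?thesis using u assms by simp
  qed
  finally show "binet x - binet (x + 1) \<le> 1 / (12 * x * (x + 1))"
    using assms by (simp add: binet_diff)
qed

section \<open>Vanishing of Binet's function at infinity\<close>

text \<open>The sequence decreases because its unit differences are positive. Their upper bound
  telescopes as \<open>1 / (12 * y) - 1 / (12 * (y + 1))\<close>, so subtracting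
  \<open>1 / (12 * y)\<close> gives an increasing minorant.\<close>

lemma convergent_binet:
  assumes "x > 0"
  shows "convergent (\<lambda>n. binet (x + real n))"
proof -
  define B where "B n = binet (x + real n)" for n
  define C where "C n = binet (x + real n) - 1 / (12 * (x + real n))" for n
  have "B (Suc n) \<le> B n" for n
  proof -
    have "0 \<le> 1 / (12 * (x + real n + 1/2)^2)" by simp
    also have "\<dots> < B n - B (Suc n)"
      using binet_diff_bounds(1)[of "x + real n"] assms by (simp add: B_def add_ac)
    finally show ?thesis by simp
  qed
  then have dec: "decseq B" by (simp add: decseq_Suc_iff)
  have "C n \<le> C (Suc n)" for n
  proof -
    define y where "y = x + real n"
    have y: "y > 0" using assms by (simp add: y_def)
    have "1 / (12 * y * (y + 1)) = 1 / (12 * y) - 1 / (12 * (y + 1))"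
      using y by (simp add: field_simps)
    then show ?thesis
      using binet_diff_bounds(2)[OF y] by (simp add: C_def y_def add_ac)
  qed
  then have inc: "incseq C" by (simp add: incseq_Suc_iff)
  have "C 0 \<le> B n" for n
  proof -
    have "C 0 \<le> C n" using inc by (simp add: incseq_def)
    also have "\<dots> \<le> B n" using assms by (simp add: B_def C_def)
    finally show ?thesis .
  qed
  then obtain L where "B \<longlonglongrightarrow> L" using decseq_convergent[OF dec] by metis
  then show ?thesis unfolding B_def by (auto simp: convergent_def)
qed

text \<open>This is the logarithm of Euler's limit
  \<open>(n - 1)! n^x / (x (x + 1) ... (x + n - 1))\<close> for \<open>Gamma x\<close>, with the
  denominator written as \<open>Gamma (x + n) / Gamma x\<close>.\<close>

lemma ln_Gamma_shift_asymp:
  fixes x :: real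
  assumes "x > 0"
  shows "(\<lambda>n. ln_Gamma (x + real n) - ln_Gamma (real n) - x * ln (real n)) \<longlonglongrightarrow> 0"
proof -
  have nonpos: "x \<notin> \<int>\<^sub>\<le>\<^sub>0" using assms by (auto elim!: nonpos_Ints_cases)
  have "(\<lambda>n. ln_Gamma x - ln (Gamma_series' x n)) \<longlonglongrightarrow> ln_Gamma x - ln (Gamma x)"
    using assms by (intro tendsto_intros Gamma_series'_LIMSEQ) (simp add: Gamma_real_pos less_imp_neq[symmetric])
  then have "(\<lambda>n. ln_Gamma x - ln (Gamma_series' x n)) \<longlonglongrightarrow> 0"
    using assms by (simp add: ln_Gamma_real_pos)
  moreover have "\<forall>\<^sub>F n in sequentially. ln_Gamma x - ln (Gamma_series' x n)
      = ln_Gamma (x + real n) - ln_Gamma (real n) - x * ln (real n)"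
    using eventually_gt_at_top[of 0]
  proof eventually_elim
    case (elim n)
    have "pochhammer x n = Gamma (x + real n) / Gamma x"
      using pochhammer_Gamma[OF nonpos] .
    then have "ln (Gamma_series' x n)
        = ln_Gamma (real n) + x * ln (real n) - (ln_Gamma (x + real n) - ln_Gamma x)"
      using assms elim Gamma_real_pos[of x] Gamma_real_pos[of "x + real n"]
      by (simp add: Gamma_series'_def ln_divide_pos ln_mult_pos ln_Gamma_real_conv_fact
            flip: ln_Gamma_real_pos)
    then show ?case by simp
  qed
  ultimately show ?thesis by (rule Lim_transform_eventually)
qed

lemma binet_shift_asymp:
  assumes "x > 0"
  shows "(\<lambda>n. binet (x + real n) - binet (real n)) \<longlonglongrightarrow> 0"
proof -
  have "(\<lambda>n. (x * ln (real n) + (real n - 1/2) * ln (real n)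
             - (x + real n - 1/2) * ln (x + real n) + x)) \<longlonglongrightarrow> 0"
    by real_asymp
  from tendsto_add[OF ln_Gamma_shift_asymp[OF assms] this] show ?thesis
    by (simp add: binet_def algebra_simps)
qed

text \<open>Legendre's formula at complex points with real value is pulled back along the injective
  \<open>complex_of_real\<close>, then logarithms are taken. It determines the constant
  \<open>ln (2 * pi) / 2\<close> in \<open>binet\<close>.\<close>

lemma ln_Gamma_real_duplication:
  fixes x :: real
  assumes "x > 0"
  shows "ln_Gamma x + ln_Gamma (x + 1/2) = (1 - 2 * x) * ln 2 + ln pi / 2 + ln_Gamma (2 * x)"
proof -
  have "complex_of_real x \<notin> \<int>\<^sub>\<le>\<^sub>0" "complex_of_real x + 1/2 \<notin> \<int>\<^sub>\<le>\<^sub>0"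
    using assms by (auto elim!: nonpos_Ints_cases simp: complex_eq_iff)
  from Gamma_legendre_duplication[OF this]
  have "complex_of_real (Gamma x * Gamma (x + 1/2))
      = complex_of_real (exp ((1 - 2 * x) * ln 2) * sqrt pi * Gamma (2 * x))"
    by (simp flip: Gamma_complex_of_real exp_of_real)
  then have "Gamma x * Gamma (x + 1/2) = exp ((1 - 2 * x) * ln 2) * sqrt pi * Gamma (2 * x)"
    by (simp only: of_real_eq_iff)
  then have "ln (Gamma x * Gamma (x + 1/2)) = ln (exp ((1 - 2 * x) * ln 2) * sqrt pi * Gamma (2 * x))"
    by simp
  then show ?thesis
    using assms Gamma_real_pos[of x] Gamma_real_pos[of "x + 1/2"] Gamma_real_pos[of "2 * x"]
    by (simp add: ln_mult_pos ln_Gamma_real_pos ln_sqrt)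
qed

lemma binet_tendsto_0:
  assumes "x > 0"
  shows "(\<lambda>n. binet (x + real n)) \<longlonglongrightarrow> 0"
proof -
  \<comment> \<open>The limit \<open>c\<close> does not depend on \<open>x\<close>; Legendre's duplication formula gives \<open>c + c - c = 0\<close>.\<close>
  obtain c where c: "(\<lambda>n. binet (1 + real n)) \<longlonglongrightarrow> c"
    using convergent_binet[of 1] by (auto simp: convergent_def)
  then have nat: "(\<lambda>n. binet (real n)) \<longlonglongrightarrow> c"
    by (subst filterlim_sequentially_Suc[symmetric]) (simp add: add_ac)
  have shift: "(\<lambda>n. binet (y + real n)) \<longlonglongrightarrow> c" if "y > 0" for y
    using tendsto_add[OF binet_shift_asymp[OF that] nat] by simp
  have even: "(\<lambda>n. binet (2 * real n)) \<longlonglongrightarrow> c"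
    using LIMSEQ_subseq_LIMSEQ[OF nat, of "(*) 2"] by (simp add: o_def strict_mono_def)
  have "(\<lambda>n. binet (real n) + binet (1/2 + real n) - binet (2 * real n)) \<longlonglongrightarrow> c + c - c"
    by (intro tendsto_intros nat shift even) simp
  moreover have "(\<lambda>n. binet (real n) + binet (1/2 + real n) - binet (2 * real n)) \<longlonglongrightarrow> 0"
  \<comment> \<open>Duplication eliminates all \<open>ln_Gamma\<close> terms and leaves this
    elementary expression.\<close>
  proof (rule Lim_transform_eventually)
    show "(\<lambda>n. (1 - 2 * real n) * ln 2 + ln pi / 2 - (real n - 1/2) * ln (real n)
        - real n * ln (1/2 + real n) + (2 * real n - 1/2) * (ln 2 + ln (real n))
        + 1/2 - (ln 2 + ln pi) / 2) \<longlonglongrightarrow> 0"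
      by real_asymp
    show "\<forall>\<^sub>F n in sequentially. (1 - 2 * real n) * ln 2 + ln pi / 2 - (real n - 1/2) * ln (real n)
        - real n * ln (1/2 + real n) + (2 * real n - 1/2) * (ln 2 + ln (real n))
        + 1/2 - (ln 2 + ln pi) / 2
        = binet (real n) + binet (1/2 + real n) - binet (2 * real n)"
      using eventually_gt_at_top[of 0]
    proof eventually_elim
      case (elim n)
      then show ?case
        using ln_Gamma_real_duplication[of "real n"]
        by (simp add: binet_def ln_mult add_ac) (simp add: field_simps)
    qed
  qed
  ultimately have "c = 0" using LIMSEQ_unique by fastforce
  with shift[OF assms] show ?thesis by simp
qed

section \<open>The trigamma function under unit shifts\<close>

lemma trigamma_diff:
  fixes x :: real
  assumes "x > 0"
  shows "Polygamma 1 x - Polygamma 1 (x + 1) = 1 / x^2"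
  using assms Polygamma_plus1[of x 1] by (simp add: power2_eq_square)

text \<open>The values are the tails of the convergent series of \<open>1 / (x + k)^2\<close> for
  \<open>Polygamma 1 x\<close>.\<close>

lemma trigamma_tendsto_0:
  fixes x :: real
  assumes "x > 0"
  shows "(\<lambda>n. Polygamma 1 (x + real n)) \<longlonglongrightarrow> 0"
proof -
  have "(\<lambda>k. 1 / (x + real k)^2) sums Polygamma 1 x"
    using Polygamma_LIMSEQ[of x 1] assms by (simp add: inverse_eq_divide power2_eq_square)
  then have "(\<lambda>n. Polygamma 1 x - (\<Sum>k<n. 1 / (x + real k)^2)) \<longlonglongrightarrow> Polygamma 1 x - Polygamma 1 x"
    unfolding sums_def by (intro tendsto_intros)
  moreover have "Polygamma 1 (x + real n) = Polygamma 1 x - (\<Sum>k<n. 1 / (x + real k)^2)" for n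
    using assms Polygamma_plus_of_nat[of n x 1] by (simp add: power2_eq_square)
  ultimately show ?thesis by simp
qed

section \<open>The two inequalities by comparison of unit differences\<close>

text \<open>A decreasing sequence stays above its limit, so \<open>f (x + 1)\<close> is nonnegative,
  and the first strict step gives positivity of \<open>f x\<close>.\<close>

lemma pos_of_shift_decreasing:
  fixes f :: "real \<Rightarrow> real"
  assumes "\<And>y. y \<ge> x \<Longrightarrow> f (y + 1) < f y" and lim: "(\<lambda>n. f (x + real n)) \<longlonglongrightarrow> 0"
  shows "f x > 0"
proof -
  have dec: "f (x + real (Suc n)) < f (x + real n)" for n
    using assms(1)[of "x + real n"] by (simp add: add_ac)
  then have "decseq (\<lambda>n. f (x + real n))"
    by (intro decseq_SucI less_imp_le)
  from decseq_ge[OF this lim, of 1] dec[of 0] show ?thesis by simp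
qed

lemma binet_less_trigamma:
  assumes "x > 0"
  shows "binet x < Polygamma 1 x / 12"
proof -
  have "0 < Polygamma 1 x / 12 - binet x"
  proof (rule pos_of_shift_decreasing[where f = "\<lambda>x. Polygamma 1 x / 12 - binet x"])
    fix y assume "y \<ge> x"
    then have y: "y > 0" using assms by simp
    have "1 / (12 * y * (y + 1)) < 1 / (12 * y^2)"
      using y by (intro divide_strict_left_mono mult_pos_pos)
        (simp_all add: power2_eq_square algebra_simps)
    then show "Polygamma 1 (y + 1) / 12 - binet (y + 1) < Polygamma 1 y / 12 - binet y"
      using binet_diff_bounds(2)[OF y] trigamma_diff[OF y] by simp
  next
    show "(\<lambda>n. Polygamma 1 (x + real n) / 12 - binet (x + real n)) \<longlonglongrightarrow> 0"
      using tendsto_diff[OF tendsto_divide[OF trigamma_tendsto_0[OF assms] tendsto_const[of 12]]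
        binet_tendsto_0[OF assms]] by simp
  qed
  then show ?thesis by simp
qed

text \<open>With shift \<open>1/2\<close> the trigamma difference, divided by 12, is exactly the
  lower bound for the difference of \<open>binet\<close>.\<close>

lemma trigamma_half_less_binet:
  assumes "x > 0"
  shows "Polygamma 1 (x + 1/2) / 12 < binet x"
proof -
  have "0 < binet x - Polygamma 1 (x + 1/2) / 12"
  proof (rule pos_of_shift_decreasing[where f = "\<lambda>x. binet x - Polygamma 1 (x + 1/2) / 12"])
    fix y assume "y \<ge> x"
    then have y: "y > 0" using assms by simp
    show "binet (y + 1) - Polygamma 1 (y + 1 + 1/2) / 12 < binet y - Polygamma 1 (y + 1/2) / 12"
      using binet_diff_bounds(1)[OF y] trigamma_diff[of "y + 1/2"] y by (simp add: add_ac)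
  next
    have "x + 1/2 > 0" using assms by simp
    from tendsto_diff[OF binet_tendsto_0[OF assms]
        tendsto_divide[OF trigamma_tendsto_0[OF this] tendsto_const[of 12]]]
    show "(\<lambda>n. binet (x + real n) - Polygamma 1 (x + real n + 1/2) / 12) \<longlonglongrightarrow> 0"
      by (simp add: add_ac)
  qed
  then show ?thesis by simp
qed

section \<open>Sharpness of the shifts 1/2 and 0\<close>

lemma binet_less_trigamma_shift:
  assumes "0 \<le> \<beta>" "\<beta> < 1/2"
  obtains x where "x > 0" "binet x < Polygamma 1 (x + \<beta>) / 12"
proof
  \<comment> \<open>The inequality \<open>(y + \<beta>)^2 < y * (y + 1)\<close> amounts to
    \<open>\<beta>^2 < y * (1 - 2 * \<beta>)\<close>; from this \<open>x\<close> on, the right side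
    is at least 1.\<close>
  define x where "x = 1 / (1 - 2 * \<beta>)"
  show x: "x > 0" using assms by (simp add: x_def)
  have "0 < Polygamma 1 (x + \<beta>) / 12 - binet x"
  proof (rule pos_of_shift_decreasing[where f = "\<lambda>x. Polygamma 1 (x + \<beta>) / 12 - binet x"])
    fix y assume yx: "y \<ge> x"
    then have y: "y > 0" using x by simp
    have "1 \<le> y * (1 - 2 * \<beta>)"
      using yx assms by (simp add: x_def field_simps)
    moreover have "\<beta>^2 < 1"
      using assms by (simp add: power_less_one_iff)
    ultimately have "(y + \<beta>)^2 < y * (y + 1)"
      by (simp add: power2_eq_square algebra_simps)
    then have "1 / (12 * y * (y + 1)) < 1 / (12 * (y + \<beta>)^2)"
      using y assms by (intro divide_strict_left_mono mult_pos_pos) (simp_all add: algebra_simps)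
    then show "Polygamma 1 (y + 1 + \<beta>) / 12 - binet (y + 1) < Polygamma 1 (y + \<beta>) / 12 - binet y"
      using binet_diff_bounds(2)[OF y] trigamma_diff[of "y + \<beta>"] y assms by (simp add: add_ac)
  next
    have "x + \<beta> > 0" using assms x by simp
    from tendsto_diff[OF tendsto_divide[OF trigamma_tendsto_0[OF this] tendsto_const[of 12]]
        binet_tendsto_0[OF x]]
    show "(\<lambda>n. Polygamma 1 (x + real n + \<beta>) / 12 - binet (x + real n)) \<longlonglongrightarrow> 0"
      by (simp add: add_ac)
  qed
  then show "binet x < Polygamma 1 (x + \<beta>) / 12" by simp
qed

lemma trigamma_shift_less_binet:
  fixes \<alpha> :: real
  assumes "\<alpha> > 0"
  obtains x where "x > 0" "Polygamma 1 (x + \<alpha>) / 12 < binet x"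
proof -
  have "filterlim (\<lambda>x. binet x) at_top (at_right 0)"
  proof -
    \<comment> \<open>Replacing \<open>ln_Gamma x\<close> by \<open>ln_Gamma (x + 1) - ln x\<close>
      isolates the singularity of \<open>binet\<close> at 0 as \<open>- ln x / 2\<close>.\<close>
    have "filterlim (\<lambda>x. - ln x / 2 + (x - x * ln x - ln (2 * pi) / 2)) at_top (at_right (0::real))"
      by real_asymp
    moreover have "((\<lambda>x::real. ln_Gamma (x + 1)) \<longlongrightarrow> 0) (at_right 0)"
    proof -
      have "isCont ln_Gamma (1::real)"
        using has_field_derivative_ln_Gamma_real[of 1] by (intro DERIV_isCont) auto
      moreover have "((\<lambda>x::real. x + 1) \<longlongrightarrow> 1) (at_right 0)" by real_asymp
      ultimately have "((\<lambda>x::real. ln_Gamma (x + 1)) \<longlongrightarrow> ln_Gamma 1) (at_right 0)"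
        by (rule isCont_tendsto_compose)
      then show ?thesis by (simp add: ln_Gamma_real_pos)
    qed
    ultimately have "filterlim (\<lambda>x. ln_Gamma (x + 1) + (- ln x / 2 + (x - x * ln x - ln (2 * pi) / 2)))
        at_top (at_right (0::real))"
      by (intro filterlim_tendsto_add_at_top[of "\<lambda>x. ln_Gamma (x + 1)" 0])
    moreover have "\<forall>\<^sub>F x in at_right (0::real).
        ln_Gamma (x + 1) + (- ln x / 2 + (x - x * ln x - ln (2 * pi) / 2)) = binet x"
      using eventually_at_right_less[of 0]
      by eventually_elim (simp add: binet_def ln_Gamma_real_plus1 algebra_simps)
    ultimately show ?thesis by (rule filterlim_mono_eventually[OF _ order_refl order_refl])
  qed
  then have "\<forall>\<^sub>F x in at_right 0. binet x > Polygamma 1 \<alpha> / 12"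
    unfolding filterlim_at_top_dense by (rule spec)
  then have "\<forall>\<^sub>F x in at_right 0. 0 < x \<and> binet x > Polygamma 1 \<alpha> / 12"
    using eventually_at_right_less[of 0] by eventually_elim simp
  then obtain x where x: "x > 0" "binet x > Polygamma 1 \<alpha> / 12"
    using eventually_happens'[OF trivial_limit_at_right_real] by blast
  moreover have "Polygamma 1 (x + \<alpha>) < Polygamma 1 \<alpha>"
    using assms x by (intro Polygamma_real_strict_antimono) auto
  ultimately show ?thesis by (intro that[of x]) auto
qed

theorem mainTheorem3:
  fixes \<alpha> \<beta> :: real
  assumes "\<alpha> \<ge> 0" and "\<beta> \<ge> 0"
  shows "(\<forall>x::real. x > 0 \<longrightarrow>
            sqrt (2 * pi) * x powr (x - 1/2) * exp (deriv Digamma (x + \<beta>) / 12 - x) < Gamma x \<and>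
            Gamma x < sqrt (2 * pi) * x powr (x - 1/2) * exp (deriv Digamma (x + \<alpha>) / 12 - x))
         \<longleftrightarrow> \<alpha> = 0 \<and> \<beta> \<ge> 1/2"
proof -
  have trigamma: "deriv Digamma (x + s) = Polygamma 1 (x + s)" if "x > 0" "s \<ge> 0" for x s :: real
  proof -
    have "x + s \<notin> \<int>\<^sub>\<le>\<^sub>0" using that by (auto elim!: nonpos_Ints_cases)
    then show ?thesis by (simp add: deriv_Polygamma)
  qed
  \<comment> \<open>The positive Stirling factor cancels and \<open>exp\<close> is strictly
    increasing, so only the exponents are compared.\<close>
  have "(\<forall>x::real. x > 0 \<longrightarrow>
            sqrt (2 * pi) * x powr (x - 1/2) * exp (deriv Digamma (x + \<beta>) / 12 - x) < Gamma x \<and>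
            Gamma x < sqrt (2 * pi) * x powr (x - 1/2) * exp (deriv Digamma (x + \<alpha>) / 12 - x))
      \<longleftrightarrow> (\<forall>x>0. Polygamma 1 (x + \<beta>) / 12 < binet x \<and> binet x < Polygamma 1 (x + \<alpha>) / 12)"
    using assms by (intro all_cong) (simp add: Gamma_conv_binet trigamma)
  also have "\<dots> \<longleftrightarrow> \<alpha> = 0 \<and> \<beta> \<ge> 1/2"
  proof (intro iffI conjI)
    assume *: "\<forall>x>0. Polygamma 1 (x + \<beta>) / 12 < binet x \<and> binet x < Polygamma 1 (x + \<alpha>) / 12"
    show "\<alpha> = 0"
      using * trigamma_shift_less_binet[of \<alpha>] assms(1) by (metis less_asym order_le_less)
    show "\<beta> \<ge> 1/2"
      using * binet_less_trigamma_shift[of \<beta>] assms(2) by (metis less_asym not_less)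
  next
    assume *: "\<alpha> = 0 \<and> \<beta> \<ge> 1/2"
    have "Polygamma 1 (x + \<beta>) / 12 < binet x" if "x > 0" for x
    proof -
      have "Polygamma 1 (x + \<beta>) \<le> Polygamma 1 (x + 1/2)"
      \<comment> \<open>Antimonotonicity of trigamma is applied in its strict form, hence the
        separate case of equal arguments.\<close>
      proof (cases "\<beta> = 1/2")
        case True
        then show ?thesis by (simp only: order_refl)
      next
        case False
        with that * show ?thesis by (intro less_imp_le Polygamma_real_strict_antimono) auto
      qed
      with trigamma_half_less_binet[OF that] show ?thesis by simp
    qed
    with * show "\<forall>x>0. Polygamma 1 (x + \<beta>) / 12 < binet x \<and> binet x < Polygamma 1 (x + \<alpha>) / 12"
      using binet_less_trigamma by simp
  qed
  finally show ?thesis .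
qed

end
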